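(* Let $A$ be a finite abelian group, written additively, and let $H$ and $K$ be abelian subgroups of $\mathrm{Aut}(A)$. Suppose that $\mathrm{Hol}(A,H)\cong\mathrm{Hol}(A,K)$ as groups and that the sum of all subgroups $(h-1)(A)=\{h(a)-a : a\in A\}$, as $h$ runs through $H$, is equal to $A$. Then $H$ and $K$ are conjugate in $\mathrm{Aut}(A)$.
   Context: For a group $G$ and a subgroup $H$ of $\mathrm{Aut}(G)$, the relative holomorph $\mathrm{Hol}(G,H)=G\rtimes H$ is the semidirect product in which $h g h^{-1}=h(g)$ for $h\in H$, $g\in G$. *)

theory Defs
  imports "HOL-Algebra.Algebra"
begin

(* The group H consists of automorphisms of G, multiplied as in AutoGroup G.  A pair (g, h)
   stands for the product g h, so that h g h^{-1} = h(g) forces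
   (g h) (g' h') = (g h(g')) (h h'). *)
definition Hol :: "('a, 'b) monoid_scheme \<Rightarrow> ('a \<Rightarrow> 'a) set \<Rightarrow> ('a \<times> ('a \<Rightarrow> 'a)) monoid"
  where "Hol G H =
    \<lparr>carrier = carrier G \<times> H,
     monoid.mult = (\<lambda>(g, h) (g', h'). (g \<otimes>\<^bsub>G\<^esub> h g', h \<otimes>\<^bsub>AutoGroup G\<^esub> h')),
     one = (\<one>\<^bsub>G\<^esub>, \<one>\<^bsub>AutoGroup G\<^esub>)\<rparr>"

(* The subset (h - 1)(A) of an abelian group A, which is written multiplicatively here. *)
definition displacement :: "('a, 'b) monoid_scheme \<Rightarrow> ('a \<Rightarrow> 'a) \<Rightarrow> 'a set"
  where "displacement A h = {h a \<otimes>\<^bsub>A\<^esub> inv\<^bsub>A\<^esub> a | a. a \<in> carrier A}"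

(* The sum of the family (B i), i in I, of subgroups of an abelian group, with the group operation
   written multiplicatively.  Only for finite I: finprod is 1 on an infinite index set. *)
definition subgroup_sum :: "('a, 'b) monoid_scheme \<Rightarrow> 'i set \<Rightarrow> ('i \<Rightarrow> 'a set) \<Rightarrow> 'a set"
  where "subgroup_sum A I B = {finprod A x I | x. x \<in> Pi I B}"

definition conjugate_subgroups :: "('a, 'b) monoid_scheme \<Rightarrow> 'a set \<Rightarrow> 'a set \<Rightarrow> bool"
  where "conjugate_subgroups G H K \<longleftrightarrow>
    (\<exists>g\<in>carrier G. K = g <#\<^bsub>G\<^esub> (H #>\<^bsub>G\<^esub> inv\<^bsub>G\<^esub> g))"

lemma AutoGroup_mult:
  assumes "h \<in> auto G" "k \<in> auto G"
  shows "h \<otimes>\<^bsub>AutoGroup G\<^esub> k = compose (carrier G) h k"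
  using assms by (simp add: AutoGroup_def BijGroup_def auto_def)

lemma (in group) auto_apply:
  assumes "h \<in> auto G" "x \<in> carrier G"
  shows "h x \<in> carrier G"
  using assms by (auto simp: auto_def hom_def)

lemma (in group) group_Hol:
  assumes H: "subgroup H (AutoGroup G)"
  shows "group (Hol G H)"
proof -
  interpret Aut: group "AutoGroup G" by (rule AutoGroup)
  interpret H: subgroup H "AutoGroup G" by (rule H)
  have car: "carrier (AutoGroup G) = auto G" by (simp add: AutoGroup_def)
  have sub: "h \<in> auto G" if "h \<in> H" for h using H.subset that car by auto
  have mult: "(h \<otimes>\<^bsub>AutoGroup G\<^esub> k) x = h (k x)" if "h \<in> H" "k \<in> H" "x \<in> carrier G" for h k x
    using that sub by (simp add: AutoGroup_mult compose_eq)
  have dist: "h (x \<otimes> y) = h x \<otimes> h y" if "h \<in> H" "x \<in> carrier G" "y \<in> carrier G" for h x y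
    using that sub by (auto simp: auto_def hom_def)
  have one: "\<one>\<^bsub>AutoGroup G\<^esub> x = x" if "x \<in> carrier G" for x
    using that by (simp add: AutoGroup_def BijGroup_def)
  have cl: "h x \<in> carrier G" if "h \<in> H" "x \<in> carrier G" for h x
    using that sub auto_apply by auto
  show ?thesis
  proof (rule groupI)
    fix x assume "x \<in> carrier (Hol G H)"
    then obtain g h where x: "x = (g, h)" "g \<in> carrier G" "h \<in> H" by (auto simp: Hol_def)
    let ?k = "inv\<^bsub>AutoGroup G\<^esub> h"
    have k: "?k \<in> H" using x by simp
    have "?k (inv g) \<otimes> ?k g = ?k \<one>" using x k by (simp flip: dist)
    also have "?k \<one> = \<one>"
      using k sub group_hom.hom_one[of G G ?k]
      by (auto simp: auto_def group_hom_def group_hom_axioms_def is_group)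
    finally show "\<exists>y\<in>carrier (Hol G H). y \<otimes>\<^bsub>Hol G H\<^esub> x = \<one>\<^bsub>Hol G H\<^esub>"
      using x k cl by (intro bexI[of _ "(?k (inv g), ?k)"]) (auto simp: Hol_def)
  qed (auto simp: Hol_def mult dist one cl m_assoc Aut.m_assoc)
qed

lemma (in group) Hol_conj:
  assumes H: "subgroup H (AutoGroup G)" and h: "h \<in> H" and g: "g \<in> carrier G"
  shows "(\<one>, h) \<otimes>\<^bsub>Hol G H\<^esub> (g, \<one>\<^bsub>AutoGroup G\<^esub>) \<otimes>\<^bsub>Hol G H\<^esub> inv\<^bsub>Hol G H\<^esub> (\<one>, h)
    = (h g, \<one>\<^bsub>AutoGroup G\<^esub>)"
proof -
  interpret Aut: group "AutoGroup G" by (rule AutoGroup)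
  interpret H: subgroup H "AutoGroup G" by (rule H)
  interpret Hol: group "Hol G H" by (rule group_Hol[OF H])
  have "h \<in> auto G" using H.subset h by (auto simp: AutoGroup_def)
  then have "h g \<in> carrier G" using g by (rule auto_apply)
  moreover have one: "\<one>\<^bsub>AutoGroup G\<^esub> \<one> = \<one>" by (simp add: AutoGroup_def BijGroup_def)
  ultimately have "(\<one>, h) \<otimes>\<^bsub>Hol G H\<^esub> (g, \<one>\<^bsub>AutoGroup G\<^esub>) = (h g, \<one>\<^bsub>AutoGroup G\<^esub>) \<otimes>\<^bsub>Hol G H\<^esub> (\<one>, h)"
    using h one by (simp add: Hol_def)
  moreover have "(\<one>, h) \<in> carrier (Hol G H)" "(g, \<one>\<^bsub>AutoGroup G\<^esub>) \<in> carrier (Hol G H)"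
    "(h g, \<one>\<^bsub>AutoGroup G\<^esub>) \<in> carrier (Hol G H)"
    using h g \<open>h g \<in> carrier G\<close> by (auto simp: Hol_def)
  ultimately show ?thesis by (simp add: Hol.inv_solve_right')
qed

end

(* A commutator of Hol A K has trivial K-component because K is abelian, and (h - 1) a is the
   commutator of h and a in Hol A H.  As these elements generate A, an isomorphism phi from
   Hol A H to Hol A K maps A into A, and by finiteness it restricts to an automorphism alpha
   of A.  Since A is abelian, conjugation by (a, h) acts on A as h; comparing the conjugation
   actions of x and phi x on A gives alpha h = k alpha whenever phi maps (a, h) to (b, k). *)
theory Submission
  imports Defs
begin

lemma Hol_carrier: "carrier (Hol G H) = carrier G \<times> H"
  by (simp add: Hol_def)

lemma Hol_mult:
  "(g, h) \<otimes>\<^bsub>Hol G H\<^esub> (g', h') = (g \<otimes>\<^bsub>G\<^esub> h g', h \<otimes>\<^bsub>AutoGroup G\<^esub> h')"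
  by (simp add: Hol_def)

lemma AutoGroup_carrier: "carrier (AutoGroup G) = auto G"
  by (simp add: AutoGroup_def)

lemma AutoGroup_one_apply: "x \<in> carrier G \<Longrightarrow> \<one>\<^bsub>AutoGroup G\<^esub> x = x"
  by (simp add: AutoGroup_def BijGroup_def)

text \<open>Elements of \<open>auto G\<close> are extensional: off the carrier they all take the
  value \<open>undefined\<close>, so only values on the carrier need comparison.\<close>

lemma auto_eqI:
  assumes "h \<in> auto G" "k \<in> auto G" "\<And>x. x \<in> carrier G \<Longrightarrow> h x = k x"
  shows "h = k"
  using assms by (auto simp: auto_def Bij_def intro: extensionalityI)

text \<open>Induction on the index set. No finiteness of \<open>I\<close> is required, since over an
  infinite index set \<open>finprod\<close> defaults to the identity, which lies in
  \<open>B\<close>.\<close>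

lemma (in comm_group) finprod_mem_subgroup:
  assumes B: "subgroup B G" and x: "x \<in> I \<rightarrow> B"
  shows "finprod G x I \<in> B"
  using x
proof (induction I rule: infinite_finite_induct)
  case (insert i I)
  then have "x \<in> I \<rightarrow> carrier G" "x i \<in> carrier G"
    using subgroup.subset[OF B] by auto
  with insert show ?case
    by (simp add: subgroup.m_closed[OF B] Pi_iff)
qed (simp_all add: subgroup.one_closed[OF B])

text \<open>Composed with an isomorphism onto \<open>Hol A K\<close>, this projection gives a
  homomorphism into an abelian group, whose kernel can then be studied.\<close>

lemma hom_Hol_snd:
  "snd \<in> hom (Hol G H) (AutoGroup G\<lparr>carrier := H\<rparr>)"
  by (auto simp: hom_def Hol_def)

lemma (in group) hom_Hol_inl:
  assumes "subgroup H (AutoGroup G)"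
  shows "(\<lambda>a. (a, \<one>\<^bsub>AutoGroup G\<^esub>)) \<in> hom G (Hol G H)"
proof -
  interpret Aut: group "AutoGroup G" by (rule AutoGroup)
  show ?thesis
    using subgroup.one_closed[OF assms]
    by (auto simp: hom_def Hol_carrier Hol_mult AutoGroup_one_apply)
qed

text \<open>The factor \<open>b\<close> commutes with the abelian base group, so only
  \<open>h\<close> acts. The conjugation relation is written without inverses so that a homomorphism
  carries it over using multiplicativity alone.\<close>

lemma (in comm_group) Hol_action:
  assumes H: "subgroup H (AutoGroup G)" and b: "b \<in> carrier G" and h: "h \<in> H"
    and a: "a \<in> carrier G"
  shows "(b, h) \<otimes>\<^bsub>Hol G H\<^esub> (a, \<one>\<^bsub>AutoGroup G\<^esub>)
    = (h a, \<one>\<^bsub>AutoGroup G\<^esub>) \<otimes>\<^bsub>Hol G H\<^esub> (b, h)"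
proof -
  interpret Aut: group "AutoGroup G" by (rule AutoGroup)
  have h': "h \<in> carrier (AutoGroup G)" using subgroup.mem_carrier[OF H h] .
  then have "h a \<in> carrier G" using a by (simp add: AutoGroup_carrier auto_apply)
  with h' b show ?thesis by (simp add: Hol_mult AutoGroup_one_apply m_comm)
qed

text \<open>In \<open>Hol G H\<close> the elements \<open>a\<close> and \<open>h a\<close> are
  conjugate. A homomorphism to a commutative group identifies conjugate elements, so it kills their
  quotient \<open>d\<close>.\<close>

lemma (in comm_group) hom_Hol_displacement:
  assumes H: "subgroup H (AutoGroup G)" and C: "comm_group C" and f: "f \<in> hom (Hol G H) C"
    and h: "h \<in> H" and d: "d \<in> displacement G h"
  shows "f (d, \<one>\<^bsub>AutoGroup G\<^esub>) = \<one>\<^bsub>C\<^esub>"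
proof -
  interpret C: comm_group C by (rule C)
  let ?i = "\<lambda>a. (a, \<one>\<^bsub>AutoGroup G\<^esub>)"
  obtain a where a: "a \<in> carrier G" "d = h a \<otimes> inv a"
    using d by (auto simp: displacement_def)
  have ha: "h a \<in> carrier G"
    using a(1) subgroup.mem_carrier[OF H h] by (simp add: AutoGroup_carrier auto_apply)
  have g: "f \<circ> ?i \<in> hom G C"
    using Group.hom_compose[OF hom_Hol_inl[OF H] f] .
  interpret g: group_hom G C "f \<circ> ?i"
    using g by (simp add: group_hom_def group_hom_axioms_def is_group C.is_group)
  have mem: "(\<one>, h) \<in> carrier (Hol G H)" "?i a \<in> carrier (Hol G H)"
      "?i (h a) \<in> carrier (Hol G H)"
    using h a ha subgroup.one_closed[OF H] by (auto simp: Hol_carrier)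
  have cl: "f x \<in> carrier C" if "x \<in> carrier (Hol G H)" for x
    using f that by (auto simp: hom_def)
  \<comment> \<open>Both sides are the image under \<open>f\<close> of the same product, rewritten
    by the conjugation relation; commutativity of \<open>C\<close> then allows
    \<open>f (\<one>, h)\<close> to be cancelled.\<close>
  have "f (\<one>, h) \<otimes>\<^bsub>C\<^esub> f (?i a) = f (?i (h a)) \<otimes>\<^bsub>C\<^esub> f (\<one>, h)"
    using Hol_action[OF H one_closed h a(1)] hom_mult[OF f mem(1,2)] hom_mult[OF f mem(3,1)] by simp
  then have "f (?i (h a)) = f (?i a)"
    using cl[OF mem(1)] cl[OF mem(2)] cl[OF mem(3)] by (simp add: C.m_comm[of "f (\<one>, h)"])
  with a ha show ?thesis
    using g.hom_mult[of "h a" "inv a"] g.hom_inv[of a] cl[OF mem(2)] by simp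
qed

text \<open>The kernel of \<open>f\<close> restricted to the base group is a subgroup containing
  every displacement, hence also their sum, which is all of \<open>G\<close>.\<close>

lemma (in comm_group) hom_Hol_trivial:
  assumes H: "subgroup H (AutoGroup G)" and C: "comm_group C" and f: "f \<in> hom (Hol G H) C"
    and sum: "subgroup_sum G H (displacement G) = carrier G" and a: "a \<in> carrier G"
  shows "f (a, \<one>\<^bsub>AutoGroup G\<^esub>) = \<one>\<^bsub>C\<^esub>"
proof -
  let ?g = "f \<circ> (\<lambda>a. (a, \<one>\<^bsub>AutoGroup G\<^esub>))"
  interpret g: group_hom G C ?g
    using Group.hom_compose[OF hom_Hol_inl[OF H] f] comm_group.axioms(2)[OF C]
    by (simp add: group_hom_def group_hom_axioms_def is_group)
  obtain x where x: "x \<in> Pi H (displacement G)" "a = finprod G x H"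
    using sum a by (auto simp: subgroup_sum_def)
  have "x \<in> H \<rightarrow> kernel G C ?g"
  proof
    fix h assume h: "h \<in> H"
    then have d: "x h \<in> displacement G h" using x by auto
    moreover have "h b \<in> carrier G" if "b \<in> carrier G" for b
      using that subgroup.mem_carrier[OF H h] by (simp add: AutoGroup_carrier auto_apply)
    ultimately show "x h \<in> kernel G C ?g"
      using hom_Hol_displacement[OF H C f h] by (auto simp: kernel_def displacement_def)
  qed
  then have "a \<in> kernel G C ?g"
    using finprod_mem_subgroup[OF g.subgroup_kernel] x by simp
  then show ?thesis by (simp add: kernel_def)
qed

text \<open>Multiplying each intertwining relation on the right by the inverse of \<open>g\<close>
  turns it into a conjugation. The two assumptions on \<open>H\<close> and \<open>K\<close> give the
  two inclusions.\<close>

lemma conjugate_subgroupsI: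
  assumes "group G" and sub: "H \<subseteq> carrier G" "K \<subseteq> carrier G" and g: "g \<in> carrier G"
    and H: "\<And>h. h \<in> H \<Longrightarrow> \<exists>k\<in>K. k \<otimes>\<^bsub>G\<^esub> g = g \<otimes>\<^bsub>G\<^esub> h"
    and K: "\<And>k. k \<in> K \<Longrightarrow> \<exists>h\<in>H. k \<otimes>\<^bsub>G\<^esub> g = g \<otimes>\<^bsub>G\<^esub> h"
  shows "conjugate_subgroups G H K"
proof -
  interpret group G by fact
  have eq: "k = g \<otimes>\<^bsub>G\<^esub> (h \<otimes>\<^bsub>G\<^esub> inv\<^bsub>G\<^esub> g)"
    if h: "h \<in> H" and k: "k \<in> K" and kg: "k \<otimes>\<^bsub>G\<^esub> g = g \<otimes>\<^bsub>G\<^esub> h" for h k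
  proof -
    have mem: "h \<in> carrier G" "k \<in> carrier G" using h k sub by auto
    have "k = g \<otimes>\<^bsub>G\<^esub> h \<otimes>\<^bsub>G\<^esub> inv\<^bsub>G\<^esub> g"
      using inv_solve_right[of k "g \<otimes>\<^bsub>G\<^esub> h" g] mem g kg by simp
    also have "\<dots> = g \<otimes>\<^bsub>G\<^esub> (h \<otimes>\<^bsub>G\<^esub> inv\<^bsub>G\<^esub> g)"
      using mem g by (simp add: m_assoc)
    finally show ?thesis .
  qed
  have "K = (\<lambda>h. g \<otimes>\<^bsub>G\<^esub> (h \<otimes>\<^bsub>G\<^esub> inv\<^bsub>G\<^esub> g)) ` H"
  proof (intro equalityI subsetI)
    fix k assume "k \<in> K"
    then show "k \<in> (\<lambda>h. g \<otimes>\<^bsub>G\<^esub> (h \<otimes>\<^bsub>G\<^esub> inv\<^bsub>G\<^esub> g)) ` H"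
      using K eq by blast
  next
    fix x assume "x \<in> (\<lambda>h. g \<otimes>\<^bsub>G\<^esub> (h \<otimes>\<^bsub>G\<^esub> inv\<^bsub>G\<^esub> g)) ` H"
    then obtain h where h: "h \<in> H" "x = g \<otimes>\<^bsub>G\<^esub> (h \<otimes>\<^bsub>G\<^esub> inv\<^bsub>G\<^esub> g)" by blast
    then show "x \<in> K" using H[OF h(1)] eq[OF h(1)] by auto
  qed
  then have "K = g <#\<^bsub>G\<^esub> (H #>\<^bsub>G\<^esub> inv\<^bsub>G\<^esub> g)"
    by (auto simp: l_coset_def r_coset_def)
  with g show ?thesis by (auto simp: conjugate_subgroups_def)
qed

theorem corollary3p4:
  fixes A :: "('a, 'b) monoid_scheme" and H K :: "('a \<Rightarrow> 'a) set"
  assumes "comm_group A" and "finite (carrier A)"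
    and "subgroup H (AutoGroup A)" and "comm_group (AutoGroup A\<lparr>carrier := H\<rparr>)"
    and "subgroup K (AutoGroup A)" and "comm_group (AutoGroup A\<lparr>carrier := K\<rparr>)"
    and "Hol A H \<cong> Hol A K"
    and "subgroup_sum A H (displacement A) = carrier A"
  shows "conjugate_subgroups (AutoGroup A) H K"
proof -
  interpret A: comm_group A by fact
  interpret Aut: group "AutoGroup A" by (rule A.AutoGroup)
  interpret H: subgroup H "AutoGroup A" by fact
  interpret K: subgroup K "AutoGroup A" by fact
  let ?e = "\<one>\<^bsub>AutoGroup A\<^esub>"
  obtain \<phi> where "\<phi> \<in> iso (Hol A H) (Hol A K)"
    using assms(7) by (auto simp: is_iso_def)
  then have hom: "\<phi> \<in> hom (Hol A H) (Hol A K)"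
    and bij: "bij_betw \<phi> (carrier A \<times> H) (carrier A \<times> K)"
    by (auto simp: iso_def Hol_carrier)
  \<comment> \<open>The restriction to the carrier makes \<alpha> extensional, as membership in
    \<open>auto A\<close> demands.\<close>
  define \<alpha> where "\<alpha> = (\<lambda>a\<in>carrier A. fst (\<phi> (a, ?e)))"
  have \<phi>_mem: "\<phi> (a, h) \<in> carrier A \<times> K" if "a \<in> carrier A" "h \<in> H" for a h
    using bij that by (auto dest: bij_betwE)
  \<comment> \<open>The map \<open>snd \<circ> \<phi>\<close> goes into the commutative group on
    \<open>K\<close>, so it is trivial on the base group.\<close>
  have \<phi>_\<alpha>: "\<phi> (a, ?e) = (\<alpha> a, ?e)" if "a \<in> carrier A" for a
    using A.hom_Hol_trivial[OF assms(3,6) Group.hom_compose[OF hom hom_Hol_snd] assms(8) that] that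
    by (simp add: \<alpha>_def prod_eq_iff)
  have \<alpha>_mem: "\<alpha> a \<in> carrier A" if "a \<in> carrier A" for a
    using \<phi>_mem[OF that H.one_closed] \<phi>_\<alpha>[OF that] by simp
  have "inj_on \<alpha> (carrier A)"
  proof (rule inj_onI)
    fix a b assume "a \<in> carrier A" "b \<in> carrier A" "\<alpha> a = \<alpha> b"
    then have "\<phi> (a, ?e) = \<phi> (b, ?e)" by (simp add: \<phi>_\<alpha>)
    then show "a = b"
      using inj_onD[OF bij_betw_imp_inj_on[OF bij], of "(a, ?e)" "(b, ?e)"]
        \<open>a \<in> carrier A\<close> \<open>b \<in> carrier A\<close> by simp
  qed
  \<comment> \<open>The generation hypothesis concerns \<open>H\<close> only, so the same argument
    is not at hand for the inverse of \<phi>; surjectivity comes instead from injectivity on a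
    finite set.\<close>
  then have "bij_betw \<alpha> (carrier A) (carrier A)"
    using \<alpha>_mem assms(2) by (simp add: bij_betw_def endo_inj_surj image_subsetI)
  moreover have "\<alpha> (a \<otimes>\<^bsub>A\<^esub> b) = \<alpha> a \<otimes>\<^bsub>A\<^esub> \<alpha> b" if "a \<in> carrier A" "b \<in> carrier A" for a b
    using hom_mult[OF Group.hom_compose[OF A.hom_Hol_inl[OF assms(3)] hom] that] that \<alpha>_mem
    by (simp add: \<phi>_\<alpha> Hol_mult AutoGroup_one_apply)
  ultimately have \<alpha>: "\<alpha> \<in> auto A"
    using \<alpha>_mem by (auto simp: auto_def Bij_def hom_def \<alpha>_def)
  \<comment> \<open>The base component \<open>a\<close> is left arbitrary because a preimage of a
    given element of \<open>K\<close> under \<phi> may have a nontrivial one.\<close>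
  have key: "k \<otimes>\<^bsub>AutoGroup A\<^esub> \<alpha> = \<alpha> \<otimes>\<^bsub>AutoGroup A\<^esub> h"
    if a: "a \<in> carrier A" and h: "h \<in> H" and \<phi>: "\<phi> (a, h) = (b, k)" for a h b k
  proof (rule auto_eqI)
    have k: "b \<in> carrier A" "k \<in> K" using \<phi>_mem[OF a h] \<phi> by auto
    have auto: "h \<in> auto A" "k \<in> auto A"
      using h k H.subset K.subset by (auto simp: AutoGroup_carrier)
    then show "k \<otimes>\<^bsub>AutoGroup A\<^esub> \<alpha> \<in> auto A" "\<alpha> \<otimes>\<^bsub>AutoGroup A\<^esub> h \<in> auto A"
      using \<alpha> Aut.m_closed by (simp_all add: AutoGroup_carrier)
    fix x assume x: "x \<in> carrier A"
    have hx: "h x \<in> carrier A" "k (\<alpha> x) \<in> carrier A"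
      using auto x \<alpha>_mem A.auto_apply by auto
    have mem: "(a, h) \<in> carrier (Hol A H)" "(x, ?e) \<in> carrier (Hol A H)"
        "(h x, ?e) \<in> carrier (Hol A H)"
      using a h x hx by (auto simp: Hol_carrier)
    have "(k (\<alpha> x), ?e) \<otimes>\<^bsub>Hol A K\<^esub> (b, k) = (b, k) \<otimes>\<^bsub>Hol A K\<^esub> (\<alpha> x, ?e)"
      using A.Hol_action[OF assms(5) k \<alpha>_mem[OF x]] by simp
    also have "\<dots> = \<phi> ((a, h) \<otimes>\<^bsub>Hol A H\<^esub> (x, ?e))"
      using hom_mult[OF hom mem(1,2)] \<phi> x by (simp add: \<phi>_\<alpha>)
    also have "\<dots> = (\<alpha> (h x), ?e) \<otimes>\<^bsub>Hol A K\<^esub> (b, k)"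
      using hom_mult[OF hom mem(3,1)] \<phi> hx A.Hol_action[OF assms(3) a h x] by (simp add: \<phi>_\<alpha>)
    \<comment> \<open>Reading off first components leaves the same factor \<open>b\<close> on both
      sides, which cancels.\<close>
    finally have "k (\<alpha> x) \<otimes>\<^bsub>A\<^esub> b = \<alpha> (h x) \<otimes>\<^bsub>A\<^esub> b"
      using k by (simp add: Hol_mult AutoGroup_one_apply)
    then have "k (\<alpha> x) = \<alpha> (h x)"
      using k hx \<alpha>_mem by simp
    then show "(k \<otimes>\<^bsub>AutoGroup A\<^esub> \<alpha>) x = (\<alpha> \<otimes>\<^bsub>AutoGroup A\<^esub> h) x"
      using auto \<alpha> x by (simp add: AutoGroup_mult compose_eq)
  qed
  show ?thesis
  proof (rule conjugate_subgroupsI[OF A.AutoGroup H.subset K.subset])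
    show "\<alpha> \<in> carrier (AutoGroup A)" using \<alpha> by (simp add: AutoGroup_carrier)
    show "\<exists>k\<in>K. k \<otimes>\<^bsub>AutoGroup A\<^esub> \<alpha> = \<alpha> \<otimes>\<^bsub>AutoGroup A\<^esub> h" if h: "h \<in> H" for h
    proof -
      obtain b k where "\<phi> (\<one>\<^bsub>A\<^esub>, h) = (b, k)" "k \<in> K"
        using \<phi>_mem[OF A.one_closed h] by auto
      then show ?thesis using key[OF A.one_closed h] by auto
    qed
    \<comment> \<open>Here surjectivity of \<phi> supplies \<open>h\<close>, as the second component
      of a preimage of \<open>(\<one>, k)\<close>.\<close>
    show "\<exists>h\<in>H. k \<otimes>\<^bsub>AutoGroup A\<^esub> \<alpha> = \<alpha> \<otimes>\<^bsub>AutoGroup A\<^esub> h" if "k \<in> K" for k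
    proof -
      have "(\<one>\<^bsub>A\<^esub>, k) \<in> \<phi> ` (carrier A \<times> H)"
        using bij_betw_imp_surj_on[OF bij] that by simp
      then obtain a h where "a \<in> carrier A" "h \<in> H" "\<phi> (a, h) = (\<one>\<^bsub>A\<^esub>, k)"
        by (elim imageE) auto
      then show ?thesis using key by auto
    qed
  qed
qed

end
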